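(* Let $\mathcal G$ be a connected and compact metric graph with a set $\mathsf V_D$ of Dirichlet vertices, each of degree one, with $\mathsf V_D\neq\emptyset$, and standard conditions at all vertices in $\mathsf V\setminus\mathsf V_D$. Let $-\Delta$ be the corresponding Laplacian. Then there exist a strictly increasing infinite sequence $(\lambda_k)_{k\in\mathbb N}$ of eigenvalues of $-\Delta$ and a sequence $(\psi_k)_{k\in\mathbb N}$ of corresponding eigenfunctions ($-\Delta\psi_k=\lambda_k\psi_k$) such that each $\psi_k$ has full support, i.e. $\psi_k$ does not vanish identically on any edge of $\mathcal G$.
   Context: Metric graphs: a compact metric graph $\mathcal G=(\mathsf G,\ell)$ consists of a finite combinatorial graph $\mathsf G$ with vertex set $\mathsf V$ and non-empty edge set $\mathsf E$ (without loops; parallel edges allowed) in which each edge $\mathsf e$ is identified with an interval $[0,\ell_{\mathsf e}]$, $\ell_{\mathsf e}\in(0,\infty)$; the endpoints $0$ and $\ell_{\mathsf e}$ are identified with the initial and the terminal vertex of $\mathsf e$. It is connected if $\mathsf G$ is connected. $\mathsf E_{\mathsf v}$ denotes the set of edges incident to $\mathsf v$, and the degree of $\mathsf v$ is the number of these edges. Laplacian: $-\Delta$ acts edgewise as $-\frac{\mathrm d^2}{\mathrm dx_{\mathsf e}^2}$ in $L^2(\mathcal G)=\bigoplus_{\mathsf e}L^2(0,\ell_{\mathsf e})$ on functions $f$ that are edgewise in the Sobolev space $H^2(0,\ell_{\mathsf e})$ and satisfy: at each $\mathsf v\in\mathsf V_D$ the Dirichlet condition $f(\mathsf v)=0$; at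 each $\mathsf v\in\mathsf V\setminus\mathsf V_D$ the standard conditions, i.e. $f$ is continuous at $\mathsf v$ and $\sum_{\mathsf e\in\mathsf E_{\mathsf v}}\partial_{\mathsf e}f(\mathsf v)=0$, where $\partial_{\mathsf e}f(\mathsf v)$ is the outward derivative, i.e. $-f_{\mathsf e}'(0)$ if $\mathsf v$ is the initial vertex of $\mathsf e$ and $f_{\mathsf e}'(\ell_{\mathsf e})$ if $\mathsf v$ is the terminal vertex. This operator is self-adjoint and non-negative with purely discrete spectrum. *)

theory Defs
  imports "HOL-Analysis.Analysis" "Graph_Theory.Graph_Theory"
begin

section \<open>Sobolev spaces on an interval\<close>

text \<open>Smooth functions with compact support in the open interval from 0 to \<open>l\<close>.\<close>

definition test_function :: "real \<Rightarrow> (real \<Rightarrow> real) \<Rightarrow> bool" where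
  "test_function l \<phi> \<longleftrightarrow>
     (\<forall>n x. (deriv ^^ n) \<phi> differentiable (at x)) \<and> closure {x. \<phi> x \<noteq> 0} \<subseteq> {0<..<l}"

definition square_integrable :: "real \<Rightarrow> (real \<Rightarrow> complex) \<Rightarrow> bool" where
  "square_integrable l f \<longleftrightarrow>
     f \<in> borel_measurable (lebesgue_on {0<..<l}) \<and>
     integrable (lebesgue_on {0<..<l}) (\<lambda>x. (cmod (f x))\<^sup>2)"

text \<open>\<open>g\<close> is a weak derivative of order \<open>n\<close> of \<open>f\<close>. Real test functions suffice, by linearity.\<close>

definition has_weak_derivative ::
    "nat \<Rightarrow> real \<Rightarrow> (real \<Rightarrow> complex) \<Rightarrow> (real \<Rightarrow> complex) \<Rightarrow> bool" where
  "has_weak_derivative n l f g \<longleftrightarrow>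
     (\<forall>\<phi>. test_function l \<phi> \<longrightarrow>
        (LINT x|lebesgue_on {0<..<l}. (deriv ^^ n) \<phi> x *\<^sub>R f x) =
        (- 1) ^ n * (LINT x|lebesgue_on {0<..<l}. \<phi> x *\<^sub>R g x))"

definition sobolev_H :: "nat \<Rightarrow> real \<Rightarrow> (real \<Rightarrow> complex) \<Rightarrow> bool" where
  "sobolev_H k l f \<longleftrightarrow>
     square_integrable l f \<and>
     (\<forall>n\<in>{1..k}. \<exists>g. square_integrable l g \<and> has_weak_derivative n l f g)"


section \<open>Metric graphs\<close>

text \<open>
  A multigraph with an arbitrary orientation of its edges: edge \<open>e\<close> is the interval from 0,
  identified with \<open>tail G e\<close>, to \<open>len e\<close>, identified with \<open>head G e\<close>.
\<close>

locale compact_metric_graph = fin_digraph G + loopfree_digraph G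
  for G :: "('v, 'e) pre_digraph" +
  fixes len :: "'e \<Rightarrow> real"
  assumes arcs_nonempty: "arcs G \<noteq> {}"
    and len_pos: "e \<in> arcs G \<Longrightarrow> 0 < len e"

text \<open>Edges are counted irrespective of their orientation.\<close>

definition incident_edges :: "('v, 'e) pre_digraph \<Rightarrow> 'v \<Rightarrow> 'e set" where
  "incident_edges G v = in_arcs G v \<union> out_arcs G v"

definition vertex_degree :: "('v, 'e) pre_digraph \<Rightarrow> 'v \<Rightarrow> nat" where
  "vertex_degree G v = card (incident_edges G v)"

text \<open>
  The following two are meant for edges \<open>e\<close> incident to \<open>v\<close>; as there are no loops, \<open>v\<close> is
  exactly one of the two ends of \<open>e\<close>.
\<close>

definition end_value ::
    "('v, 'e) pre_digraph \<Rightarrow> ('e \<Rightarrow> real) \<Rightarrow> ('e \<Rightarrow> real \<Rightarrow> complex) \<Rightarrow> 'v \<Rightarrow> 'e \<Rightarrow> complex" where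
  "end_value G len f v e = (if v = tail G e then f e 0 else f e (len e))"

definition outward_derivative ::
    "('v, 'e) pre_digraph \<Rightarrow> ('e \<Rightarrow> real) \<Rightarrow> ('e \<Rightarrow> real \<Rightarrow> complex) \<Rightarrow> 'v \<Rightarrow> 'e \<Rightarrow> complex" where
  "outward_derivative G len f v e =
     (if v = tail G e then - vector_derivative (f e) (at 0 within {0..len e})
      else vector_derivative (f e) (at (len e) within {0..len e}))"

definition dirichlet_condition ::
    "('v, 'e) pre_digraph \<Rightarrow> ('e \<Rightarrow> real) \<Rightarrow> ('e \<Rightarrow> real \<Rightarrow> complex) \<Rightarrow> 'v \<Rightarrow> bool" where
  "dirichlet_condition G len f v \<longleftrightarrow> (\<forall>e\<in>incident_edges G v. end_value G len f v e = 0)"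

definition standard_condition ::
    "('v, 'e) pre_digraph \<Rightarrow> ('e \<Rightarrow> real) \<Rightarrow> ('e \<Rightarrow> real \<Rightarrow> complex) \<Rightarrow> 'v \<Rightarrow> bool" where
  "standard_condition G len f v \<longleftrightarrow>
     (\<forall>e\<in>incident_edges G v. \<forall>e'\<in>incident_edges G v.
        end_value G len f v e = end_value G len f v e') \<and>
     (\<Sum>e\<in>incident_edges G v. outward_derivative G len f v e) = 0"


section \<open>The Laplacian\<close>

text \<open>
  An element of the domain is a class of functions modulo null sets. It is represented here by a
  family \<open>f\<close> that is continuous on each closed edge. By Sobolev embedding, a function in \<open>H\<^sup>2\<close>
  has exactly one such representative, and that one is continuously differentiable up to the
  ends, so that the end values and the one-sided derivatives above are its traces.
\<close>

definition laplacian_domain ::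
    "('v, 'e) pre_digraph \<Rightarrow> ('e \<Rightarrow> real) \<Rightarrow> 'v set \<Rightarrow> ('e \<Rightarrow> real \<Rightarrow> complex) set" where
  "laplacian_domain G len VD = {f.
     (\<forall>e\<in>arcs G. sobolev_H 2 (len e) (f e) \<and> continuous_on {0..len e} (f e)) \<and>
     (\<forall>v\<in>VD. dirichlet_condition G len f v) \<and>
     (\<forall>v\<in>verts G - VD. standard_condition G len f v)}"

text \<open>
  The operator as a relation between \<open>f\<close> in the domain and \<open>g = - \<Delta> f\<close> in \<open>L\<^sup>2\<close>, because \<open>g\<close> is
  determined only up to null sets.
\<close>

definition neg_laplacian ::
    "('v, 'e) pre_digraph \<Rightarrow> ('e \<Rightarrow> real) \<Rightarrow> 'v set \<Rightarrow>
     ('e \<Rightarrow> real \<Rightarrow> complex) \<Rightarrow> ('e \<Rightarrow> real \<Rightarrow> complex) \<Rightarrow> bool" where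
  "neg_laplacian G len VD f g \<longleftrightarrow>
     f \<in> laplacian_domain G len VD \<and>
     (\<forall>e\<in>arcs G. square_integrable (len e) (g e) \<and>
        has_weak_derivative 2 (len e) (f e) (\<lambda>x. - g e x))"

definition vanishes_on_edge :: "('e \<Rightarrow> real) \<Rightarrow> ('e \<Rightarrow> real \<Rightarrow> complex) \<Rightarrow> 'e \<Rightarrow> bool" where
  "vanishes_on_edge len f e \<longleftrightarrow> (\<forall>x\<in>{0..len e}. f e x = 0)"

definition eigenfunction ::
    "('v, 'e) pre_digraph \<Rightarrow> ('e \<Rightarrow> real) \<Rightarrow> 'v set \<Rightarrow> complex \<Rightarrow> ('e \<Rightarrow> real \<Rightarrow> complex) \<Rightarrow> bool" where
  "eigenfunction G len VD \<mu> f \<longleftrightarrow>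
     (\<exists>e\<in>arcs G. \<not> vanishes_on_edge len f e) \<and>
     neg_laplacian G len VD f (\<lambda>e x. \<mu> * f e x)"

definition eigenvalue ::
    "('v, 'e) pre_digraph \<Rightarrow> ('e \<Rightarrow> real) \<Rightarrow> 'v set \<Rightarrow> complex \<Rightarrow> bool" where
  "eigenvalue G len VD \<mu> \<longleftrightarrow> (\<exists>f. eigenfunction G len VD \<mu> f)"

definition full_support ::
    "('v, 'e) pre_digraph \<Rightarrow> ('e \<Rightarrow> real) \<Rightarrow> ('e \<Rightarrow> real \<Rightarrow> complex) \<Rightarrow> bool" where
  "full_support G len f \<longleftrightarrow> (\<forall>e\<in>arcs G. \<not> vanishes_on_edge len f e)"

end

theory Submission
  imports Defs
begin

text \<open>
  An eigenfunction with eigenvalue \<open>k\<^sup>2\<close> is determined by its vertex values \<open>u\<close> when no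
  \<open>sin (k * len e)\<close> vanishes, and the vertex conditions say that \<open>u\<close> is a critical point of a
  quadratic form which depends on \<open>k\<close> only through the angles \<open>k * len e\<close> modulo \<open>2 * pi\<close>. While
  all angles lie between 0 and \<open>pi\<close>, the form has nonpositive off-diagonal terms. It is positive
  definite for small angles, and it takes negative values when the largest angle is close to
  \<open>pi\<close>; hence for some \<open>k\<close> between it is nonnegative and has a nonnegative null vector. By
  connectedness this vector is strictly positive at the vertices without Dirichlet condition, so
  the eigenfunction has full support. All this survives a small shift of the angles. By Dirichlet's
  theorem on simultaneous approximation there are arbitrarily large \<open>t\<close> for which all
  \<open>t * len e\<close> are close to multiples of \<open>2 * pi\<close>, and \<open>k + t\<close> then yields arbitrarily large
  eigenvalues. An edge with two Dirichlet ends has no free vertex value, but it is the whole graph.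
\<close>

section \<open>Weak derivatives and eigenfunctions\<close>

lemma integrable_lebesgue_on_open_interval:
  fixes f :: "real \<Rightarrow> 'a::euclidean_space"
  assumes "continuous_on {a..b} f"
  shows "integrable (lebesgue_on {a<..<b}) f"
proof -
  have "f absolutely_integrable_on {a..b}"
    using assms by (rule absolutely_integrable_continuous_real)
  then have "f absolutely_integrable_on {a<..<b}"
    by (rule set_integrable_subset) auto
  then show ?thesis
    by (simp add: integrable_restrict_space set_integrable_def)
qed

lemma square_integrable_continuous:
  assumes "continuous_on {0..l} f"
  shows "square_integrable l f"
  unfolding square_integrable_def
proof
  show "f \<in> borel_measurable (lebesgue_on {0<..<l})"
    using integrable_lebesgue_on_open_interval[OF assms] by auto
  show "integrable (lebesgue_on {0<..<l}) (\<lambda>x. (cmod (f x))\<^sup>2)"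
    by (intro integrable_lebesgue_on_open_interval continuous_intros assms)
qed

lemma deriv_eq_0_outside_support:
  assumes "x \<notin> closure {x. \<phi> x \<noteq> 0}"
  shows "deriv \<phi> x = (0::real)"
proof -
  have "eventually (\<lambda>y. y \<in> - closure {x. \<phi> x \<noteq> 0}) (nhds x)"
    using assms by (intro eventually_nhds_in_open) auto
  then have "eventually (\<lambda>y. \<phi> y = 0) (nhds x)"
    by eventually_elim (use closure_subset[of "{x. \<phi> x \<noteq> 0}"] in blast)
  then have "deriv \<phi> x = deriv (\<lambda>_. 0) x"
    by (intro deriv_cong_ev) auto
  then show ?thesis by simp
qed

lemma test_function_deriv:
  assumes "test_function l \<phi>"
  shows "test_function l (deriv \<phi>)"
  unfolding test_function_def
proof (intro conjI allI)
  show "(deriv ^^ n) (deriv \<phi>) differentiable (at x)" for n x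
    using assms unfolding test_function_def
    by (metis funpow_Suc_right o_apply)
  have "{x. deriv \<phi> x \<noteq> 0} \<subseteq> closure {x. \<phi> x \<noteq> 0}"
    using deriv_eq_0_outside_support by blast
  then have "closure {x. deriv \<phi> x \<noteq> 0} \<subseteq> closure {x. \<phi> x \<noteq> 0}"
    by (simp add: closure_minimal)
  then show "closure {x. deriv \<phi> x \<noteq> 0} \<subseteq> {0<..<l}"
    using assms unfolding test_function_def by blast
qed

lemma test_function_funpow_deriv:
  "test_function l \<phi> \<Longrightarrow> test_function l ((deriv ^^ n) \<phi>)"
  by (induction n) (auto intro: test_function_deriv)

lemma test_function_has_vector_derivative:
  assumes "test_function l \<phi>"
  shows "(\<phi> has_vector_derivative deriv \<phi> x) (at x)"
proof -
  have "(deriv ^^ 0) \<phi> differentiable (at x)"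
    using assms unfolding test_function_def by blast
  then show ?thesis
    using DERIV_deriv_iff_real_differentiable has_real_derivative_iff_has_vector_derivative by auto
qed

lemma test_function_continuous:
  "test_function l \<phi> \<Longrightarrow> continuous_on A \<phi>"
  by (meson continuous_at_imp_continuous_on has_vector_derivative_continuous
      test_function_has_vector_derivative)

text \<open>Integration by parts; the boundary terms vanish because the support of a test function
  avoids both ends. Two-sided derivatives on the whole line suit the intended \<open>f\<close>,
  which are trigonometric formulas.\<close>

lemma has_weak_derivative_1I:
  assumes "0 < l"
    and f: "\<And>x. (f has_vector_derivative f' x) (at x)"
    and f': "continuous_on {0..l} f'"
  shows "has_weak_derivative 1 l f f'"
  unfolding has_weak_derivative_def
proof (intro allI impI)
  fix \<phi> assume \<phi>: "test_function l \<phi>"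
  have cf: "continuous_on {0..l} f"
    using f by (meson continuous_at_imp_continuous_on has_vector_derivative_continuous)
  have c\<phi>: "continuous_on {0..l} \<phi>" "continuous_on {0..l} (deriv \<phi>)"
    using \<phi> by (auto intro: test_function_continuous test_function_deriv)
  have int: "integrable (lebesgue_on {0<..<l}) (\<lambda>x. deriv \<phi> x *\<^sub>R f x)"
    "integrable (lebesgue_on {0<..<l}) (\<lambda>x. \<phi> x *\<^sub>R f' x)"
    "integrable (lebesgue_on {0<..<l}) (\<lambda>x. \<phi> x *\<^sub>R f' x + deriv \<phi> x *\<^sub>R f x)"
    by (intro integrable_lebesgue_on_open_interval continuous_intros cf f' c\<phi>)+
  have z: "\<phi> x = 0" if "x \<notin> {0<..<l}" for x
    using \<phi> that closure_subset[of "{x. \<phi> x \<noteq> 0}"] unfolding test_function_def by blast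
  have "((\<lambda>x. \<phi> x *\<^sub>R f' x + deriv \<phi> x *\<^sub>R f x) has_integral (\<phi> l *\<^sub>R f l - \<phi> 0 *\<^sub>R f 0)) {0..l}"
    using \<open>0 < l\<close>
    by (intro fundamental_theorem_of_calculus has_vector_derivative_scaleR)
       (auto intro!: has_vector_derivative_at_within f test_function_has_vector_derivative[OF \<phi>]
          simp: has_real_derivative_iff_has_vector_derivative)
  then have "((\<lambda>x. \<phi> x *\<^sub>R f' x + deriv \<phi> x *\<^sub>R f x) has_integral 0) {0<..<l}"
    using z[of 0] z[of l] by (simp add: has_integral_Icc_iff_Ioo)
  then have "(LINT x|lebesgue_on {0<..<l}. \<phi> x *\<^sub>R f' x + deriv \<phi> x *\<^sub>R f x) = 0"
    using lebesgue_integral_eq_integral[OF int(3)] by (auto simp: integral_unique)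
  then have "(LINT x|lebesgue_on {0<..<l}. \<phi> x *\<^sub>R f' x) +
      (LINT x|lebesgue_on {0<..<l}. deriv \<phi> x *\<^sub>R f x) = 0"
    by (simp add: int)
  then show "(LINT x|lebesgue_on {0<..<l}. (deriv ^^ 1) \<phi> x *\<^sub>R f x) =
      (- 1) ^ 1 * (LINT x|lebesgue_on {0<..<l}. \<phi> x *\<^sub>R f' x)"
    by (simp add: eq_neg_iff_add_eq_0 add.commute)
qed

text \<open>The first-order rule is applied to \<open>(deriv ^^ n) \<phi>\<close>, which is again a
  test function.\<close>

lemma has_weak_derivative_Suc:
  assumes "has_weak_derivative 1 l f f'" "has_weak_derivative n l f' g"
  shows "has_weak_derivative (Suc n) l f g"
  unfolding has_weak_derivative_def
proof (intro allI impI)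
  fix \<phi> assume \<phi>: "test_function l \<phi>"
  have "(LINT x|lebesgue_on {0<..<l}. (deriv ^^ Suc n) \<phi> x *\<^sub>R f x) =
      - (LINT x|lebesgue_on {0<..<l}. (deriv ^^ n) \<phi> x *\<^sub>R f' x)"
    using assms(1) test_function_funpow_deriv[OF \<phi>, of n]
    unfolding has_weak_derivative_def by fastforce
  also have "\<dots> = - ((- 1) ^ n * (LINT x|lebesgue_on {0<..<l}. \<phi> x *\<^sub>R g x))"
    using assms(2) \<phi> unfolding has_weak_derivative_def by simp
  finally show "(LINT x|lebesgue_on {0<..<l}. (deriv ^^ Suc n) \<phi> x *\<^sub>R f x) =
      (- 1) ^ Suc n * (LINT x|lebesgue_on {0<..<l}. \<phi> x *\<^sub>R g x)"
    by simp
qed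

text \<open>Integrating by parts twice makes a classical solution a weak one, so that weak
  derivatives do not appear again below.\<close>

lemma eigenfunctionI:
  fixes f f' f'' :: "'e \<Rightarrow> real \<Rightarrow> complex"
  assumes G: "compact_metric_graph G len"
    and f: "\<And>e x. (f e has_vector_derivative f' e x) (at x)"
    and f': "\<And>e x. (f' e has_vector_derivative - (\<mu> * f e x)) (at x)"
    and D: "\<And>v. v \<in> VD \<Longrightarrow> dirichlet_condition G len f v"
    and St: "\<And>v. v \<in> verts G - VD \<Longrightarrow> standard_condition G len f v"
    and nz: "full_support G len f"
  shows "eigenfunction G len VD \<mu> f"
proof -
  interpret compact_metric_graph G len by (rule G)
  have cf: "continuous_on A (f e)" for e A
    using f by (meson continuous_at_imp_continuous_on has_vector_derivative_continuous)
  have cf': "continuous_on A (f' e)" for e A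
    using f' by (meson continuous_at_imp_continuous_on has_vector_derivative_continuous)
  have w1: "has_weak_derivative 1 (len e) (f e) (f' e)" if "e \<in> arcs G" for e
    by (rule has_weak_derivative_1I[OF len_pos[OF that] f cf'])
  have "has_weak_derivative 1 (len e) (f' e) (\<lambda>x. - (\<mu> * f e x))" if "e \<in> arcs G" for e
    by (rule has_weak_derivative_1I[OF len_pos[OF that] f']) (intro continuous_intros cf)
  then have w2: "has_weak_derivative 2 (len e) (f e) (\<lambda>x. - (\<mu> * f e x))" if "e \<in> arcs G" for e
    using has_weak_derivative_Suc[OF w1] that by (metis Suc_1)
  have sq: "square_integrable (len e) (\<lambda>x. - (\<mu> * f e x))" "square_integrable (len e) (f' e)"
    "square_integrable (len e) (f e)" "square_integrable (len e) (\<lambda>x. \<mu> * f e x)" for e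
    by (intro square_integrable_continuous continuous_intros cf cf')+
  have "sobolev_H 2 (len e) (f e)" if "e \<in> arcs G" for e
  proof -
    have "{1..2} = {1, 2::nat}" by auto
    then show ?thesis
      unfolding sobolev_H_def using sq w1 w2 that by (metis insert_iff singletonD)
  qed
  then have "f \<in> laplacian_domain G len VD"
    unfolding laplacian_domain_def using D St cf by blast
  moreover have "\<exists>e\<in>arcs G. \<not> vanishes_on_edge len f e"
    using nz arcs_nonempty unfolding full_support_def by blast
  ultimately show ?thesis
    unfolding eigenfunction_def neg_laplacian_def using sq w2 by auto
qed


section \<open>The quadratic form of an edge\<close>

text \<open>
  For \<open>f'' = - k\<^sup>2 f\<close> on an edge of length \<open>l\<close> with end values \<open>a\<close> and \<open>b\<close> and \<open>\<theta> = k * l\<close>,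
  the outward derivative at the end with value \<open>a\<close> is \<open>k * edge_flux \<theta> a b\<close>, and \<open>edge_flux\<close> is
  half the partial derivative of \<open>edge_form\<close> in \<open>a\<close>.
\<close>

definition edge_form :: "real \<Rightarrow> real \<Rightarrow> real \<Rightarrow> real" where
  "edge_form \<theta> a b = ((a\<^sup>2 + b\<^sup>2) * cos \<theta> - 2 * a * b) / sin \<theta>"

definition edge_flux :: "real \<Rightarrow> real \<Rightarrow> real \<Rightarrow> real" where
  "edge_flux \<theta> a b = (a * cos \<theta> - b) / sin \<theta>"

lemma edge_form_commute: "edge_form \<theta> a b = edge_form \<theta> b a"
  by (simp add: edge_form_def algebra_simps)

lemma edge_form_scale: "edge_form \<theta> (c * a) (c * b) = c\<^sup>2 * edge_form \<theta> a b"
  by (simp add: edge_form_def power_mult_distrib field_simps power2_eq_square)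

text \<open>Only the mixed term sees signs, and its coefficient \<open>- 2 / sin \<theta>\<close> is
  negative. This is why angles are kept between 0 and \<open>pi\<close>.\<close>

lemma edge_form_abs:
  assumes "0 < sin \<theta>"
  shows "edge_form \<theta> \<bar>a\<bar> \<bar>b\<bar> \<le> edge_form \<theta> a b"
proof -
  have "a * b \<le> \<bar>a\<bar> * \<bar>b\<bar>" by (metis abs_ge_self abs_mult)
  then show ?thesis
    unfolding edge_form_def using assms by (intro divide_right_mono) auto
qed

text \<open>Exact second-order expansion in one end value. If \<open>sin \<theta> = 0\<close>, every
  term is 0 because division by 0 gives 0.\<close>

lemma edge_form_add:
  "edge_form \<theta> (a + s) b = edge_form \<theta> a b + 2 * s * edge_flux \<theta> a b + s\<^sup>2 * (cos \<theta> / sin \<theta>)"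
  unfolding edge_form_def edge_flux_def
  by (cases "sin \<theta> = 0") (simp_all add: field_simps power2_eq_square)

text \<open>The numerator of \<open>edge_form\<close> is \<open>(a - b)\<^sup>2 - (a\<^sup>2 +
  b\<^sup>2) * (1 - cos \<theta>)\<close>, and \<open>(1 - cos \<theta>) / sin \<theta>\<close>
  equals \<open>tan (\<theta> / 2)\<close>, which is at most \<open>h\<close>. For small angles the
  form thus dominates a difference energy up to a small error.\<close>

lemma edge_form_lower:
  assumes "0 < \<theta>" "\<theta> \<le> h" "h \<le> 1" "0 \<le> a" "a \<le> 1" "0 \<le> b" "b \<le> 1"
  shows "(a - b)\<^sup>2 - 2 * h \<le> edge_form \<theta> a b"
proof -
  have pi: "\<theta> < pi" "\<theta> / 2 < pi / 3" using assms pi_gt3 by linarith+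
  then have s: "0 < sin \<theta>" using assms by (intro sin_gt_zero)
  have s2: "0 < sin (\<theta> / 2)" using assms pi by (intro sin_gt_zero) auto
  have "cos (pi / 3) \<le> cos (\<theta> / 2)"
    using assms pi by (intro cos_monotone_0_pi_le) auto
  then have c2: "1 / 2 \<le> cos (\<theta> / 2)" by (simp add: cos_60)
  have "sin (\<theta> / 2) \<le> h / 2"
    using assms sin_x_le_x[of "\<theta> / 2"] by linarith
  also have "\<dots> \<le> h * cos (\<theta> / 2)"
    using mult_left_mono[OF c2, of h] assms by simp
  finally have "2 * sin (\<theta> / 2) * sin (\<theta> / 2) \<le> 2 * sin (\<theta> / 2) * (h * cos (\<theta> / 2))"
    using s2 by (intro mult_left_mono) auto
  then have cs: "1 - cos \<theta> \<le> h * sin \<theta>"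
    using cos_double_sin[of "\<theta> / 2"] sin_double[of "\<theta> / 2"]
    by (simp add: power2_eq_square algebra_simps)
  have "a\<^sup>2 \<le> 1" "b\<^sup>2 \<le> 1" using assms by (simp_all add: power_le_one)
  then have "(a\<^sup>2 + b\<^sup>2) * (1 - cos \<theta>) \<le> 2 * (1 - cos \<theta>)"
    by (intro mult_right_mono) auto
  moreover have "(a - b)\<^sup>2 * sin \<theta> \<le> (a - b)\<^sup>2"
    using mult_left_mono[of "sin \<theta>" 1 "(a - b)\<^sup>2"] by simp
  ultimately have "((a - b)\<^sup>2 - 2 * h) * sin \<theta> \<le> (a\<^sup>2 + b\<^sup>2) * cos \<theta> - 2 * a * b"
    using cs by (simp add: algebra_simps power2_eq_square)
  then show ?thesis
    unfolding edge_form_def using s by (simp add: pos_le_divide_eq)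
qed

text \<open>Below \<open>pi / 2\<close> this is \<open>\<theta> \<le> tan \<theta>\<close>; from
  there on the cotangent is nonpositive. It caps the contribution of an edge whose angle is bounded
  away from 0.\<close>

lemma cot_le_inverse:
  assumes "0 < \<theta>" "\<theta> < pi"
  shows "cos \<theta> / sin \<theta> \<le> 1 / (\<theta>::real)"
proof -
  have "0 < sin \<theta>" using assms by (intro sin_gt_zero)
  moreover have "\<theta> * cos \<theta> \<le> sin \<theta>"
  proof (cases "\<theta> < pi / 2")
    case True
    have "\<theta> = arctan (tan \<theta>)" using True assms by (simp add: arctan_tan)
    also have "\<dots> \<le> tan \<theta>"
      using True assms by (intro arctan_le_self) (simp add: tan_gt_zero less_imp_le)
    finally show ?thesis
      using cos_gt_zero[of \<theta>] True assms by (simp add: tan_def field_simps)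
  next
    case False
    then have "cos \<theta> \<le> 0"
      using assms cos_monotone_0_pi_le[of "pi / 2" \<theta>] by simp
    then show ?thesis
      using assms \<open>0 < sin \<theta>\<close> by (smt (verit) mult_pos_neg mult_eq_0_iff)
  qed
  ultimately show ?thesis using assms by (simp add: field_simps)
qed

text \<open>With one nonzero end there is equality; with two,
  \<open>2 * cos \<theta> - 2 \<le> cos \<theta>\<close>. The estimate serves the indicator vector
  of the free vertices.\<close>

lemma edge_form_le_cot:
  assumes "a \<in> {0, 1}" "b \<in> {0, 1}" "a \<noteq> 0 \<or> b \<noteq> 0" "0 < sin \<theta>"
  shows "edge_form \<theta> a b \<le> cos \<theta> / sin \<theta>"
proof -
  have "(a\<^sup>2 + b\<^sup>2) * cos \<theta> - 2 * a * b \<le> cos \<theta>"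
    using assms order_trans[OF cos_le_one[of \<theta>], of 2] by auto
  then show ?thesis unfolding edge_form_def using assms by (intro divide_right_mono) auto
qed

text \<open>The pole of the cotangent at \<open>pi\<close>, quantified: it lets one edge outweigh
  all the others.\<close>

lemma cot_near_pi:
  assumes "0 < x" "x \<le> pi / 3"
  shows "cos (pi - x) / sin (pi - x) \<le> - 1 / (2 * x)"
proof -
  have s: "0 < sin x" using assms pi_gt_zero by (intro sin_gt_zero) auto
  have "cos (pi / 3) \<le> cos x" using assms by (intro cos_monotone_0_pi_le) auto
  then have "1 / 2 \<le> cos x" by (simp add: cos_60)
  moreover have "sin x \<le> x" using assms by (simp add: sin_x_le_x)
  ultimately have "sin x * 1 \<le> x * (2 * cos x)" using assms by (intro mult_mono) auto
  then show ?thesis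
    using s assms by (simp add: field_simps)
qed

lemma linear_coeff_eq_0:
  fixes B C :: real
  assumes "\<And>s. 0 \<le> 2 * s * B + s\<^sup>2 * C"
  shows "B = 0"
proof (rule ccontr)
  assume "B \<noteq> 0"
  \<comment> \<open>\<open>r\<close> is positive and dominates \<open>C\<close>, so
    \<open>s = - B / r\<close> makes the linear part win whatever the sign of
    \<open>C\<close>.\<close>
  define r where "r = \<bar>C\<bar> + 1"
  have r: "0 < r" "C \<le> r" unfolding r_def by auto
  have "2 * (- B / r) * B + (- B / r)\<^sup>2 * C \<le> 2 * (- B / r) * B + (- B / r)\<^sup>2 * r"
    using r by (intro add_left_mono mult_left_mono) auto
  also have "\<dots> = - (B\<^sup>2 / r)"
    using r by (simp add: field_simps power2_eq_square)
  also have "\<dots> < 0" using r \<open>B \<noteq> 0\<close> by simp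
  finally show False using assms[of "- B / r"] by linarith
qed

text \<open>Tychonoff's theorem. Pinning the coordinates off \<open>A\<close> to 0 lets vertex
  vectors be total functions on a possibly infinite type and still range over a compact set.\<close>

lemma compact_function_box:
  "compact {u :: 'v \<Rightarrow> real. \<forall>v. u v \<in> (if v \<in> A then {0..1} else {0})}"
proof -
  have "compactin (product_topology (\<lambda>_::'v. euclideanreal) UNIV)
      (PiE UNIV (\<lambda>v. if v \<in> A then {0..1} else {0}))"
    by (simp add: compactin_PiE)
  moreover have "PiE UNIV (\<lambda>v. if v \<in> A then {0..1} else {0}) =
      {u :: 'v \<Rightarrow> real. \<forall>v. u v \<in> (if v \<in> A then {0..1} else {0})}"
    by (simp only: PiE_UNIV_domain Pi_def) simp
  ultimately show ?thesis by (simp add: euclidean_product_topology)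
qed


section \<open>Null vectors of the vertex form\<close>

text \<open>Membership passes along arcs in both directions, hence along paths of the symmetric
  closure. Connectedness of the graph is always used through this lemma.\<close>

lemma (in wf_digraph) connected_closed_subset:
  assumes con: "Digraph_Component.connected G"
    and W: "W \<noteq> {}" "W \<subseteq> verts G"
    and closed: "\<And>e. e \<in> arcs G \<Longrightarrow> tail G e \<in> W \<longleftrightarrow> head G e \<in> W"
  shows "W = verts G"
proof -
  obtain a where a: "a \<in> W" using W by blast
  have "b \<in> W" if "b \<in> verts G" for b
  proof -
    have "a \<rightarrow>\<^sup>*\<^bsub>mk_symmetric G\<^esub> b"
      using con a W that
      unfolding Digraph_Component.connected_def strongly_connected_def by auto
    then have "(a, b) \<in> rtrancl_on (verts G) (parcs (mk_symmetric G))"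
      unfolding reachable_def by simp
    then show "b \<in> W"
      using a by (induction rule: rtrancl_on.induct) (auto simp: parcs_mk_symmetric closed)
  qed
  then show ?thesis using W by blast
qed

text \<open>The condition \<open>free_end\<close> sets aside the graph that is one edge between two
  Dirichlet vertices. It ensures that a vector positive at the free vertices is nonzero at some end
  of each edge.\<close>

locale dirichlet_graph = compact_metric_graph G len
  for G :: "('v, 'e) pre_digraph" and len +
  fixes VD :: "'v set"
  assumes graph_connected: "Digraph_Component.connected G"
    and VD_subset: "VD \<subseteq> verts G"
    and VD_nonempty: "VD \<noteq> {}"
    and VD_degree: "v \<in> VD \<Longrightarrow> vertex_degree G v = 1"
    and free_end: "e \<in> arcs G \<Longrightarrow> tail G e \<notin> VD \<or> head G e \<notin> VD"
begin

definition vertex_form :: "('e \<Rightarrow> real) \<Rightarrow> ('v \<Rightarrow> real) \<Rightarrow> real" where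
  "vertex_form \<theta> u = (\<Sum>e\<in>arcs G. edge_form (\<theta> e) (u (tail G e)) (u (head G e)))"

text \<open>Half the partial derivative of \<open>vertex_form\<close> in \<open>u v\<close> and, up
  to the factor \<open>k\<close>, the sum of the outward derivatives at \<open>v\<close>.\<close>

definition vertex_flux :: "('e \<Rightarrow> real) \<Rightarrow> ('v \<Rightarrow> real) \<Rightarrow> 'v \<Rightarrow> real" where
  "vertex_flux \<theta> u v = (\<Sum>e\<in>incident_edges G v.
     if v = tail G e then edge_flux (\<theta> e) (u (tail G e)) (u (head G e))
     else edge_flux (\<theta> e) (u (head G e)) (u (tail G e)))"

text \<open>A compact substitute for the unit sphere: by \<open>edge_form_abs\<close> nonnegative
  vectors suffice to test the sign of the form.\<close>

definition vertex_simplex :: "('v \<Rightarrow> real) set" where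
  "vertex_simplex = {u. (\<forall>v. 0 \<le> u v) \<and> (\<forall>v. v \<notin> verts G - VD \<longrightarrow> u v = 0) \<and>
     (\<Sum>v\<in>verts G. u v) = 1}"

lemma tail_neq_head: "e \<in> arcs G \<Longrightarrow> tail G e \<noteq> head G e"
  by (rule no_loops)

lemma dirichlet_edge_unique:
  assumes "v \<in> VD" "e \<in> incident_edges G v" "e' \<in> incident_edges G v"
  shows "e = e'"
  using VD_degree[OF assms(1)] assms(2,3) unfolding vertex_degree_def
  by (metis card_1_singletonE singletonD)

lemma vertex_simplex_le_1:
  assumes "u \<in> vertex_simplex"
  shows "u v \<le> 1"
proof (cases "v \<in> verts G")
  case True
  then have "u v \<le> (\<Sum>v\<in>verts G. u v)"
    using assms by (intro member_le_sum) (auto simp: vertex_simplex_def)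
  then show ?thesis using assms by (simp add: vertex_simplex_def)
qed (use assms in \<open>auto simp: vertex_simplex_def\<close>)

lemma compact_vertex_simplex: "compact vertex_simplex"
proof -
  let ?B = "{u. \<forall>v. u v \<in> (if v \<in> verts G - VD then {0..1} else {0::real})}"
  let ?f = "\<lambda>u::'v \<Rightarrow> real. \<Sum>v\<in>verts G. u v"
  have "continuous_on ?B ?f"
    by (intro continuous_intros continuous_on_subset[OF continuous_on_product_coordinates]) auto
  then have "closedin (top_of_set ?B) (?B \<inter> ?f -` {1})"
    by (rule continuous_closedin_preimage) auto
  then have "compact (?B \<inter> ?f -` {1})"
    by (rule closedin_compact[OF compact_function_box])
  moreover have "vertex_simplex = ?B \<inter> ?f -` {1}"
  proof (intro equalityI subsetI)
    fix u assume "u \<in> vertex_simplex"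
    then show "u \<in> ?B \<inter> ?f -` {1}"
      using vertex_simplex_le_1[of u] by (simp add: vertex_simplex_def)
  next
    fix u assume u: "u \<in> ?B \<inter> ?f -` {1}"
    then have "u v \<in> (if v \<in> verts G - VD then {0..1} else {0})" for v by simp
    then have "0 \<le> u v" "v \<notin> verts G - VD \<Longrightarrow> u v = 0" for v
      by (metis atLeastAtMost_iff order_refl singletonD, metis singletonD)
    then show "u \<in> vertex_simplex"
      using u by (simp add: vertex_simplex_def)
  qed
  ultimately show ?thesis by simp
qed

text \<open>The pairs of a parameter and a vector with nonpositive form make up a compact set. At
  its least parameter the form is still nonnegative, as a limit from the left of positive
  values.\<close>

lemma ex_first_null_vector:
  fixes \<theta> :: "real \<Rightarrow> 'e \<Rightarrow> real"
  assumes "\<alpha> \<le> \<beta>"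
    and cont: "\<And>e. e \<in> arcs G \<Longrightarrow> continuous_on {\<alpha>..\<beta>} (\<lambda>k. \<theta> k e)"
    and sin: "\<And>e k. e \<in> arcs G \<Longrightarrow> k \<in> {\<alpha>..\<beta>} \<Longrightarrow> 0 < sin (\<theta> k e)"
    and pos: "\<And>u. u \<in> vertex_simplex \<Longrightarrow> 0 < vertex_form (\<theta> \<alpha>) u"
    and neg: "u0 \<in> vertex_simplex" "vertex_form (\<theta> \<beta>) u0 \<le> 0"
  obtains k u where "k \<in> {\<alpha>..\<beta>}" "u \<in> vertex_simplex" "vertex_form (\<theta> k) u = 0"
    "\<forall>w\<in>vertex_simplex. 0 \<le> vertex_form (\<theta> k) w"
proof -
  let ?X = "{\<alpha>..\<beta>} \<times> vertex_simplex"
  let ?q = "\<lambda>p. vertex_form (\<theta> (fst p)) (snd p)"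
  have coord: "continuous_on ?X (\<lambda>p. snd p v)" for v
    by (rule continuous_on_compose2[OF continuous_on_product_coordinates[of v]])
       (auto intro: continuous_intros)
  \<comment> \<open>\<open>continuous_on_sin\<close> needs a Hausdorff domain, and the type of functions to \<open>real\<close> is not
    known to be one.\<close>
  have trig: "continuous_on ?X (\<lambda>p. cos (\<theta> (fst p) e))"
    "continuous_on ?X (\<lambda>p. sin (\<theta> (fst p) e))" if "e \<in> arcs G" for e
    by (rule continuous_on_compose2[OF continuous_on_cos[OF cont[OF that]]]
        continuous_on_compose2[OF continuous_on_sin[OF cont[OF that]]];
        force intro: continuous_intros)+
  have "sin (\<theta> k e) \<noteq> 0" if "e \<in> arcs G" "k \<in> {\<alpha>..\<beta>}" for e k
    using sin[OF that] by simp
  then have "continuous_on ?X ?q"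
    unfolding vertex_form_def edge_form_def by (intro continuous_intros coord trig) auto
  then have "closedin (top_of_set ?X) (?X \<inter> ?q -` {..0})"
    by (rule continuous_closedin_preimage) auto
  then have "compact (?X \<inter> ?q -` {..0})"
    by (rule closedin_compact[rotated]) (intro compact_Times compact_Icc compact_vertex_simplex)
  then have "compact (fst ` (?X \<inter> ?q -` {..0}))"
    by (rule compact_continuous_image[rotated]) (intro continuous_intros)
  moreover have "fst ` (?X \<inter> ?q -` {..0}) \<noteq> {}"
    using neg \<open>\<alpha> \<le> \<beta>\<close> by force
  ultimately have "\<exists>k\<in>fst ` (?X \<inter> ?q -` {..0}). \<forall>k'\<in>fst ` (?X \<inter> ?q -` {..0}). k \<le> k'"
    by (rule compact_attains_inf)
  then obtain k where k: "k \<in> fst ` (?X \<inter> ?q -` {..0})"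
    and least: "\<forall>k'\<in>fst ` (?X \<inter> ?q -` {..0}). k \<le> k'" ..
  obtain u where u: "k \<in> {\<alpha>..\<beta>}" "u \<in> vertex_simplex" "vertex_form (\<theta> k) u \<le> 0"
    using k by auto
  have before: "0 < vertex_form (\<theta> k') w" if "w \<in> vertex_simplex" "k' \<in> {\<alpha>..<k}" for w k'
  proof (rule ccontr)
    assume "\<not> 0 < vertex_form (\<theta> k') w"
    then have "(k', w) \<in> ?X \<inter> ?q -` {..0}" using that u by auto
    then have "k' \<in> fst ` (?X \<inter> ?q -` {..0})" by (rule image_eqI[rotated]) simp
    then have "k \<le> k'" using least by (rule bspec[rotated])
    then show False using that by simp
  qed
  \<comment> \<open>Strictness leaves parameters below \<open>k\<close> from which to take the
    limit.\<close>
  have "\<alpha> < k"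
  proof (rule ccontr)
    assume "\<not> \<alpha> < k"
    then have "k = \<alpha>" using u by simp
    then show False using pos u by fastforce
  qed
  have nonneg: "0 \<le> vertex_form (\<theta> k) w" if w: "w \<in> vertex_simplex" for w
  proof (rule tendsto_lowerbound)
    have "continuous_on {\<alpha>..\<beta>} (\<lambda>k. vertex_form (\<theta> k) w)"
      unfolding vertex_form_def edge_form_def
      by (intro continuous_intros cont) (use sin in force)+
    then have "((\<lambda>k. vertex_form (\<theta> k) w) \<longlongrightarrow> vertex_form (\<theta> k) w) (at k within {\<alpha>..\<beta>})"
      using u(1) by (simp add: continuous_on_def)
    then show "((\<lambda>k. vertex_form (\<theta> k) w) \<longlongrightarrow> vertex_form (\<theta> k) w) (at k within {\<alpha>..<k})"
      by (rule tendsto_within_subset) (use u in auto)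
    show "\<forall>\<^sub>F k' in at k within {\<alpha>..<k}. 0 \<le> vertex_form (\<theta> k') w"
      unfolding eventually_at_filter using before[OF w] by (auto intro!: always_eventually less_imp_le)
    show "at k within {\<alpha>..<k} \<noteq> bot"
      using \<open>\<alpha> < k\<close> by (simp add: at_within_eq_bot_iff)
  qed
  show ?thesis
    using that[OF u(1,2)] nonneg u(2,3) by (meson antisym)
qed

text \<open>Absolute values do not increase the form, and scaling multiplies it by a square. Signed
  vectors are needed because a null vector is going to be perturbed in both directions.\<close>

lemma vertex_form_nonneg_extend:
  assumes sin: "\<And>e. e \<in> arcs G \<Longrightarrow> 0 < sin (\<theta> e)"
    and nonneg: "\<forall>w\<in>vertex_simplex. 0 \<le> vertex_form \<theta> w"
    and u: "\<And>v. v \<notin> verts G - VD \<Longrightarrow> u v = 0"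
  shows "0 \<le> vertex_form \<theta> u"
proof -
  define r where "r = (\<Sum>v\<in>verts G. \<bar>u v\<bar>)"
  have abs_le: "vertex_form \<theta> (\<lambda>v. \<bar>u v\<bar>) \<le> vertex_form \<theta> u"
    unfolding vertex_form_def by (intro sum_mono edge_form_abs sin)
  have "0 \<le> vertex_form \<theta> (\<lambda>v. \<bar>u v\<bar>)"
  proof (cases "r = 0")
    case True
    then have "u v = 0" if "v \<in> verts G" for v
      using that unfolding r_def by (simp add: sum_nonneg_eq_0_iff)
    then show ?thesis by (simp add: vertex_form_def edge_form_def)
  next
    case False
    then have r: "0 < r" unfolding r_def by (simp add: sum_nonneg order_less_le)
    have "(\<lambda>v. \<bar>u v\<bar> / r) \<in> vertex_simplex"
      unfolding vertex_simplex_def using r u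
      by (auto simp: sum_divide_distrib[symmetric] r_def[symmetric])
    then have "0 \<le> r\<^sup>2 * vertex_form \<theta> (\<lambda>v. \<bar>u v\<bar> / r)" using nonneg by simp
    also have "\<dots> = vertex_form \<theta> (\<lambda>v. \<bar>u v\<bar>)"
      unfolding vertex_form_def sum_distrib_left
      using r by (intro sum.cong) (simp_all add: edge_form_scale[symmetric])
    finally show ?thesis .
  qed
  then show ?thesis using abs_le by linarith
qed

lemma incident_edgesD:
  "e \<in> incident_edges G v \<Longrightarrow> e \<in> arcs G \<and> (v = tail G e \<or> v = head G e)"
  unfolding incident_edges_def by auto

lemma finite_incident_edges: "finite (incident_edges G v)"
  by (rule finite_subset[of _ "arcs G"]) (auto dest: incident_edgesD)

text \<open>Only edges at \<open>v\<close> change and, without loops, \<open>v\<close> is exactly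
  one end of each, so \<open>edge_form_add\<close> applies to every such edge.\<close>

lemma vertex_form_fun_upd:
  "vertex_form \<theta> (u(v := u v + s)) =
     vertex_form \<theta> u + 2 * s * vertex_flux \<theta> u v +
     s\<^sup>2 * (\<Sum>e\<in>incident_edges G v. cos (\<theta> e) / sin (\<theta> e))"
proof -
  let ?w = "u(v := u v + s)"
  let ?d = "\<lambda>e. edge_form (\<theta> e) (?w (tail G e)) (?w (head G e))
    - edge_form (\<theta> e) (u (tail G e)) (u (head G e))"
  have "vertex_form \<theta> ?w - vertex_form \<theta> u = (\<Sum>e\<in>arcs G. ?d e)"
    unfolding vertex_form_def by (simp add: sum_subtractf)
  also have "\<dots> = (\<Sum>e\<in>incident_edges G v. ?d e)"
    by (rule sum.mono_neutral_right) (auto simp: incident_edges_def)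
  also have "\<dots> = (\<Sum>e\<in>incident_edges G v.
      2 * s * (if v = tail G e then edge_flux (\<theta> e) (u (tail G e)) (u (head G e))
        else edge_flux (\<theta> e) (u (head G e)) (u (tail G e)))
      + s\<^sup>2 * (cos (\<theta> e) / sin (\<theta> e)))"
  proof (rule sum.cong[OF refl])
    fix e assume "e \<in> incident_edges G v"
    then consider "v = tail G e" "v \<noteq> head G e" | "v = head G e" "v \<noteq> tail G e"
      using tail_neq_head incident_edgesD by metis
    then show "?d e = 2 * s * (if v = tail G e
        then edge_flux (\<theta> e) (u (tail G e)) (u (head G e))
        else edge_flux (\<theta> e) (u (head G e)) (u (tail G e)))
      + s\<^sup>2 * (cos (\<theta> e) / sin (\<theta> e))"
    proof cases
      case 1
      then show ?thesis by (simp add: edge_form_add)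
    next
      case 2
      then show ?thesis
        by (simp add: edge_form_add edge_form_commute[of _ "u (tail G e)"])
    qed
  qed
  finally show ?thesis
    unfolding vertex_flux_def by (simp add: sum.distrib sum_distrib_left)
qed

text \<open>A null vector of a nonnegative form is a minimum, so the linear term in each free
  coordinate vanishes.\<close>

lemma vertex_flux_eq_0:
  assumes sin: "\<And>e. e \<in> arcs G \<Longrightarrow> 0 < sin (\<theta> e)"
    and nonneg: "\<forall>w\<in>vertex_simplex. 0 \<le> vertex_form \<theta> w"
    and u: "u \<in> vertex_simplex" "vertex_form \<theta> u = 0"
    and v: "v \<in> verts G - VD"
  shows "vertex_flux \<theta> u v = 0"
proof (rule linear_coeff_eq_0)
  fix s
  have "0 \<le> vertex_form \<theta> (u(v := u v + s))"
    using u v by (intro vertex_form_nonneg_extend[OF sin nonneg]) (auto simp: vertex_simplex_def)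
  then show "0 \<le> 2 * s * vertex_flux \<theta> u v +
      s\<^sup>2 * (\<Sum>e\<in>incident_edges G v. cos (\<theta> e) / sin (\<theta> e))"
    unfolding vertex_form_fun_upd using u by simp
qed

lemma null_vector_pos:
  assumes sin: "\<And>e. e \<in> arcs G \<Longrightarrow> 0 < sin (\<theta> e)"
    and u: "u \<in> vertex_simplex"
    and flux: "\<And>v. v \<in> verts G - VD \<Longrightarrow> vertex_flux \<theta> u v = 0"
    and v: "v \<in> verts G - VD"
  shows "0 < u v"
proof (rule ccontr)
  assume "\<not> 0 < u v"
  have u0: "0 \<le> u w" for w using u by (simp add: vertex_simplex_def)
  \<comment> \<open>At a zero all terms of the flux have one sign, so zeros spread to all neighbours. The set
    \<open>W\<close> adds the Dirichlet vertices that hang on a zero, to be closed under adjacency in \<open>G\<close>.\<close>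
  define Z where "Z = {w \<in> verts G - VD. u w = 0}"
  have "v \<in> Z" using \<open>\<not> 0 < u v\<close> u0[of v] v by (simp add: Z_def)
  have nb: "u (tail G e) = 0 \<and> u (head G e) = 0"
    if "w \<in> Z" "e \<in> incident_edges G w" for w e
  proof -
    let ?t = "\<lambda>e. if w = tail G e then edge_flux (\<theta> e) (u (tail G e)) (u (head G e))
      else edge_flux (\<theta> e) (u (head G e)) (u (tail G e))"
    have uw: "u w = 0" "w \<in> verts G - VD" using that by (auto simp: Z_def)
    have np: "?t e' \<le> 0" if "e' \<in> incident_edges G w" for e'
      using incident_edgesD[OF that] sin[of e'] u0 uw
      by (auto simp: edge_flux_def divide_nonpos_pos)
    have "(\<Sum>e\<in>incident_edges G w. ?t e) = 0"
      using flux[OF uw(2)] by (simp add: vertex_flux_def)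
    then have "(\<Sum>e\<in>incident_edges G w. - ?t e) = 0" by (simp only: sum_negf)
    then have "?t e = 0"
      using sum_nonneg_eq_0_iff[OF finite_incident_edges, of w "\<lambda>e. - ?t e"] np that(2)
      by fastforce
    then show ?thesis
      using incident_edgesD[OF that(2)] sin[of e] uw by (auto simp: edge_flux_def split: if_splits)
  qed
  define W where "W = Z \<union> {d \<in> VD. \<exists>e\<in>incident_edges G d. tail G e \<in> Z \<or> head G e \<in> Z}"
  have inc: "e \<in> incident_edges G (tail G e)" "e \<in> incident_edges G (head G e)"
    if "e \<in> arcs G" for e
    using that by (auto simp: incident_edges_def)
  have verts: "tail G e \<in> verts G" "head G e \<in> verts G" if "e \<in> arcs G" for e
    using that by auto
  have "W = verts G"
  proof (rule connected_closed_subset[OF graph_connected])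
    show "W \<noteq> {}" using \<open>v \<in> Z\<close> by (auto simp: W_def)
    show "W \<subseteq> verts G" using VD_subset by (auto simp: W_def Z_def)
    fix e assume e: "e \<in> arcs G"
    have Z_VD: "w \<notin> VD" if "w \<in> Z" for w using that by (simp add: Z_def)
    show "tail G e \<in> W \<longleftrightarrow> head G e \<in> W"
    proof
      assume "tail G e \<in> W"
      \<comment> \<open>If the tail is a Dirichlet vertex, \<open>e\<close> is its only edge, so it
        is the head of \<open>e\<close> that lies in \<open>Z\<close>.\<close>
      then consider "tail G e \<in> Z" | "tail G e \<in> VD" "head G e \<in> Z"
        unfolding W_def using dirichlet_edge_unique[OF _ inc(1)[OF e]] Z_VD by blast
      then show "head G e \<in> W"
      proof cases
        case 1
        then show ?thesis
          using nb[OF 1 inc(1)[OF e]] inc[OF e] verts[OF e] by (auto simp: W_def Z_def)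
      qed (simp add: W_def)
    next
      assume "head G e \<in> W"
      then consider "head G e \<in> Z" | "head G e \<in> VD" "tail G e \<in> Z"
        unfolding W_def using dirichlet_edge_unique[OF _ inc(2)[OF e]] Z_VD by blast
      then show "tail G e \<in> W"
      proof cases
        case 1
        then show ?thesis
          using nb[OF 1 inc(2)[OF e]] inc[OF e] verts[OF e] by (auto simp: W_def Z_def)
      qed (simp add: W_def)
    qed
  qed
  then have "u w = 0" if "w \<in> verts G" for w
    using that u by (auto simp: W_def Z_def vertex_simplex_def)
  then show False using u by (simp add: vertex_simplex_def)
qed

text \<open>By compactness the energy attains its minimum. Zero energy would make \<open>u\<close>
  constant along edges, hence 0 everywhere because a Dirichlet vertex exists, against the coordinate
  sum 1.\<close>

lemma poincare_constant:
  obtains c where "0 < c"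
    "\<And>u. u \<in> vertex_simplex \<Longrightarrow> c \<le> (\<Sum>e\<in>arcs G. (u (tail G e) - u (head G e))\<^sup>2)"
proof (cases "vertex_simplex = {}")
  case True
  then show ?thesis using that[of 1] by auto
next
  case False
  let ?p = "\<lambda>u. \<Sum>e\<in>arcs G. (u (tail G e) - u (head G e))\<^sup>2 :: real"
  have "continuous_on vertex_simplex ?p"
    by (intro continuous_intros continuous_on_subset[OF continuous_on_product_coordinates]) auto
  from continuous_attains_inf[OF compact_vertex_simplex False this]
  obtain u where u: "u \<in> vertex_simplex" "\<forall>w\<in>vertex_simplex. ?p u \<le> ?p w" ..
  have "?p u \<noteq> 0"
  proof
    assume "?p u = 0"
    then have eq: "u (tail G e) = u (head G e)" if "e \<in> arcs G" for e
      using that by (simp add: sum_nonneg_eq_0_iff)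
    have "{v \<in> verts G. u v = 0} = verts G"
    proof (rule connected_closed_subset[OF graph_connected])
      show "{v \<in> verts G. u v = 0} \<noteq> {}"
        using VD_nonempty VD_subset u(1) by (auto simp: vertex_simplex_def)
    qed (auto simp: eq)
    then have "u v = 0" if "v \<in> verts G" for v using that by blast
    then show False using u(1) by (simp add: vertex_simplex_def)
  qed
  then have "0 < ?p u" by (simp add: sum_nonneg order_less_le)
  then show ?thesis using that u by blast
qed

end


section \<open>Recurrence of the angles\<close>

text \<open>Dirichlet's theorem is applied to the numbers \<open>T * l a / (2 * pi)\<close>. Thanks
  to the factor \<open>T\<close>, a denominator \<open>q \<ge> 1\<close> already gives
  \<open>t = q * T \<ge> T\<close>.\<close>

lemma simultaneous_recurrence:
  fixes l :: "'a \<Rightarrow> real"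
  assumes "finite A" "0 < T" "0 < \<gamma>"
  obtains t p where "T \<le> t" "\<And>a. a \<in> A \<Longrightarrow> \<bar>t * l a - 2 * pi * of_int (p a)\<bar> \<le> \<gamma>"
proof -
  obtain g :: "'a \<Rightarrow> nat" and n where g: "g ` A = {i. i < n}" "inj_on g A"
    using finite_imp_inj_to_nat_seg[OF \<open>finite A\<close>] by auto
  define \<theta> where "\<theta> i = T * l (inv_into A g i) / (2 * pi)" for i
  obtain N :: nat where N: "2 * pi / \<gamma> < real N" using reals_Archimedean2 by blast
  moreover have "0 < 2 * pi / \<gamma>" using \<open>0 < \<gamma>\<close> by simp
  ultimately have "0 < N" by (cases N) auto
  then obtain q p where qp: "0 < q" "\<And>i. i < n \<Longrightarrow> \<bar>of_int q * \<theta> i - of_int (p i)\<bar> < 1 / N"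
    using Dirichlet_approx_simult by metis
  have "\<bar>(of_int q * T) * l a - 2 * pi * of_int (p (g a))\<bar> \<le> \<gamma>" if "a \<in> A" for a
  proof -
    have "\<theta> (g a) = T * l a / (2 * pi)" using g that by (simp add: \<theta>_def)
    then have "(of_int q * T) * l a - 2 * pi * of_int (p (g a)) =
        (2 * pi) * (of_int q * \<theta> (g a) - of_int (p (g a)))"
      by (simp add: field_simps)
    then have "\<bar>(of_int q * T) * l a - 2 * pi * of_int (p (g a))\<bar> =
        (2 * pi) * \<bar>of_int q * \<theta> (g a) - of_int (p (g a))\<bar>"
      by (simp add: abs_mult)
    also have "\<dots> \<le> (2 * pi) * (1 / N)"
    proof (intro mult_left_mono)
      have "g a \<in> {i. i < n}" using g(1) that by blast
      then show "\<bar>of_int q * \<theta> (g a) - of_int (p (g a))\<bar> \<le> 1 / N" using qp(2) by (simp add: less_imp_le)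
    qed simp
    also have "\<dots> \<le> \<gamma>"
      using N \<open>0 < N\<close> \<open>0 < \<gamma>\<close> by (simp add: field_simps)
    finally show ?thesis .
  qed
  moreover have "1 * T \<le> of_int q * T"
    using qp(1) \<open>0 < T\<close> by (intro mult_right_mono) auto
  ultimately show ?thesis using that[of "of_int q * T" "\<lambda>a. p (g a)"] by simp
qed

lemma has_vector_derivative_complex_of_real:
  assumes "(g has_real_derivative D) (at x)"
  shows "((\<lambda>x. complex_of_real (g x)) has_vector_derivative complex_of_real D) (at x)"
  using assms by (simp add: has_real_derivative_iff_has_vector_derivative has_vector_derivative_of_real)

section \<open>Eigenfunctions of full support with arbitrarily large eigenvalues\<close>

context dirichlet_graph
begin

text \<open>The margin \<open>\<gamma>\<close> is fixed before the shift \<open>\<delta>\<close>,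
  since the shift will come from recurrence with precision \<open>\<gamma>\<close>. Hence the
  estimates at both ends of the range of \<open>k\<close> are uniform in the shift; only
  \<open>k\<close> and \<open>u\<close> depend on it.\<close>

lemma ex_null_vector_near:
  obtains \<gamma> where "0 < \<gamma>"
    "\<And>\<delta>. (\<And>e. e \<in> arcs G \<Longrightarrow> \<bar>\<delta> e\<bar> \<le> \<gamma>) \<Longrightarrow>
       \<exists>k>0. \<exists>u. (\<forall>v\<in>verts G - VD. 0 < u v) \<and> (\<forall>v\<in>VD. u v = 0) \<and>
         (\<forall>e\<in>arcs G. 0 < sin (k * len e + \<delta> e)) \<and>
         (\<forall>v\<in>verts G - VD. vertex_flux (\<lambda>e. k * len e + \<delta> e) u v = 0)"
proof -
  let ?n = "real (card (arcs G))"
  have n: "1 \<le> ?n" using arcs_nonempty by (simp add: Suc_le_eq card_gt_0_iff)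
  define lmax where "lmax = Max (len ` arcs G)"
  define lmin where "lmin = Min (len ` arcs G)"
  have le: "lmin \<le> len e" "len e \<le> lmax" if "e \<in> arcs G" for e
    using that by (simp_all add: lmin_def lmax_def)
  obtain e0 where e0: "e0 \<in> arcs G" "len e0 = lmax"
    using Max_in[of "len ` arcs G"] arcs_nonempty unfolding lmax_def by fastforce
  have "lmin \<in> len ` arcs G" unfolding lmin_def using arcs_nonempty by (intro Min_in) auto
  then have lmin: "0 < lmin" using len_pos by auto
  then have lmax: "0 < lmax" "lmin \<le> lmax" using le[OF e0(1)] by auto
  obtain c where c: "0 < c"
    "\<And>u. u \<in> vertex_simplex \<Longrightarrow> c \<le> (\<Sum>e\<in>arcs G. (u (tail G e) - u (head G e))\<^sup>2)"
    by (rule poincare_constant) blast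
  \<comment> \<open>Each edge loses at most \<open>2 * h\<close> in \<open>edge_form_lower\<close>;
    this keeps the total loss within \<open>c / 2\<close>.\<close>
  define h where "h = min 1 (c / (4 * ?n))"
  have h: "0 < h" "h \<le> 1" "4 * ?n * h \<le> c"
    using c n by (auto simp: h_def min_def field_simps)
  \<comment> \<open>\<open>2 * m\<close> is the angle of the shortest edge when the longest has
    angle \<open>pi\<close>; halving it leaves room for errors of order
    \<open>\<gamma>\<close>.\<close>
  define m where "m = lmin * pi / (2 * lmax)"
  have m: "0 < m" "m \<le> pi / 2"
    using lmin lmax by (auto simp: m_def field_simps)
  \<comment> \<open>The first bound pushes the longest edge's contribution at \<open>\<beta>\<close>
    down to \<open>- ?n / m\<close>; the second keeps the shifted angles at \<open>\<alpha>\<close>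
    positive.\<close>
  define \<gamma> where "\<gamma> = min (m / (6 * ?n)) (h * lmin / (4 * lmax))"
  have \<gamma>: "0 < \<gamma>" "\<gamma> * (6 * ?n) \<le> m" "\<gamma> \<le> h * lmin / (4 * lmax)"
  proof -
    show "0 < \<gamma>" unfolding \<gamma>_def using m n h lmin lmax by simp
    have "\<gamma> \<le> m / (6 * ?n)" unfolding \<gamma>_def by simp
    then show "\<gamma> * (6 * ?n) \<le> m" using n by (simp add: le_divide_eq)
  qed (simp add: \<gamma>_def)
  have "\<gamma> * 6 \<le> \<gamma> * (6 * ?n)" using \<gamma> n by (intro mult_left_mono) auto
  then have \<gamma>6: "\<gamma> * 6 \<le> m" using \<gamma> by linarith
  \<comment> \<open>At \<open>\<alpha>\<close> all angles are below \<open>h\<close>, even after a shift by \<open>\<gamma>\<close>; at \<open>\<beta>\<close> the longest edge has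
    an angle within \<open>3 * \<gamma>\<close> of \<open>pi\<close>, and all angles are at least \<open>m\<close>.\<close>
  define \<alpha> where "\<alpha> = h / (2 * lmax)"
  define \<beta> where "\<beta> = (pi - 2 * \<gamma>) / lmax"
  have \<alpha>: "0 < \<alpha>" unfolding \<alpha>_def using h lmax by simp
  have "h / 2 \<le> pi - 2 * \<gamma>" using h \<gamma>6 m pi_gt3 by linarith
  then have \<alpha>\<beta>: "\<alpha> \<le> \<beta>"
    unfolding \<alpha>_def \<beta>_def using lmax divide_right_mono[of "h / 2" "pi - 2 * \<gamma>" lmax] by simp
  have \<alpha>l: "\<alpha> * len e \<le> h / 2" "2 * \<gamma> \<le> \<alpha> * len e" if "e \<in> arcs G" for e
  proof -
    have "\<alpha> * len e \<le> \<alpha> * lmax" "\<alpha> * lmin \<le> \<alpha> * len e"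
      using le[OF that] \<alpha> by (auto intro: mult_left_mono)
    then show "\<alpha> * len e \<le> h / 2" "2 * \<gamma> \<le> \<alpha> * len e"
      using \<gamma>(3) lmax by (simp_all add: \<alpha>_def)
  qed
  have \<beta>l: "\<beta> * len e \<le> pi - 2 * \<gamma>" "2 * m - m / 3 \<le> \<beta> * len e" if "e \<in> arcs G" for e
  proof -
    have \<beta>0: "0 \<le> \<beta>" using \<alpha> \<alpha>\<beta> by simp
    then have "\<beta> * len e \<le> \<beta> * lmax" using le[OF that] by (intro mult_left_mono) auto
    then show "\<beta> * len e \<le> pi - 2 * \<gamma>" using lmax by (simp add: \<beta>_def)
    have "2 * \<gamma> * (lmin / lmax) \<le> 2 * \<gamma> * 1"
      using \<gamma> lmin lmax by (intro mult_left_mono) auto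
    moreover have "\<beta> * lmin = 2 * m - 2 * \<gamma> * (lmin / lmax)"
      using lmax by (simp add: \<beta>_def m_def field_simps)
    moreover have "\<beta> * lmin \<le> \<beta> * len e" using \<beta>0 le[OF that] by (intro mult_left_mono) auto
    ultimately show "2 * m - m / 3 \<le> \<beta> * len e" using \<gamma>6 by linarith
  qed
  have "\<exists>k>0. \<exists>u. (\<forall>v\<in>verts G - VD. 0 < u v) \<and> (\<forall>v\<in>VD. u v = 0) \<and>
      (\<forall>e\<in>arcs G. 0 < sin (k * len e + \<delta> e)) \<and>
      (\<forall>v\<in>verts G - VD. vertex_flux (\<lambda>e. k * len e + \<delta> e) u v = 0)"
    if \<delta>: "\<And>e. e \<in> arcs G \<Longrightarrow> \<bar>\<delta> e\<bar> \<le> \<gamma>" for \<delta>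
  proof -
    define \<theta> where "\<theta> k e = k * len e + \<delta> e" for k e
    have range: "0 < \<theta> k e" "\<theta> k e < pi" if "e \<in> arcs G" "k \<in> {\<alpha>..\<beta>}" for e k
    proof -
      have "\<alpha> * len e \<le> k * len e" "k * len e \<le> \<beta> * len e"
        using that len_pos[of e] by (auto intro: mult_right_mono)
      then show "0 < \<theta> k e" "\<theta> k e < pi"
        using \<alpha>l[OF that(1)] \<beta>l[OF that(1)] \<delta>[OF that(1)] \<gamma>(1) unfolding \<theta>_def by linarith+
    qed
    then have sin: "0 < sin (\<theta> k e)" if "e \<in> arcs G" "k \<in> {\<alpha>..\<beta>}" for e k
      using that by (intro sin_gt_zero)
    have pos: "0 < vertex_form (\<theta> \<alpha>) u" if u: "u \<in> vertex_simplex" for u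
    proof -
      have "\<gamma> \<le> h / 2" using \<alpha>l[OF e0(1)] \<gamma>(1) by linarith
      have "c - 2 * h * ?n \<le> (\<Sum>e\<in>arcs G. (u (tail G e) - u (head G e))\<^sup>2 - 2 * h)"
        using c(2)[OF u] by (simp add: sum_subtractf algebra_simps)
      also have "\<dots> \<le> vertex_form (\<theta> \<alpha>) u"
        unfolding vertex_form_def
      proof (rule sum_mono)
        fix e assume e: "e \<in> arcs G"
        have "\<theta> \<alpha> e \<le> h"
          using \<alpha>l[OF e] \<delta>[OF e] \<open>\<gamma> \<le> h / 2\<close> unfolding \<theta>_def by linarith
        then show "(u (tail G e) - u (head G e))\<^sup>2 - 2 * h
            \<le> edge_form (\<theta> \<alpha> e) (u (tail G e)) (u (head G e))"
          using range[OF e, of \<alpha>] \<alpha>\<beta> h vertex_simplex_le_1[OF u] u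
          by (intro edge_form_lower) (auto simp: vertex_simplex_def)
      qed
      finally have "c - 2 * h * ?n \<le> vertex_form (\<theta> \<alpha>) u" .
      moreover have "2 * h * ?n < c" using h c n by (simp add: algebra_simps)
      ultimately show ?thesis by linarith
    qed
    \<comment> \<open>The test vector for \<open>\<beta>\<close>: by \<open>free_end\<close> every
      edge has an end with value 1, as \<open>edge_form_le_cot\<close> requires.\<close>
    define one where "one v = (if v \<in> verts G - VD then 1 else 0 :: real)" for v
    define r where "r = (\<Sum>v\<in>verts G. one v)"
    have "0 < r"
    proof -
      obtain v where "v \<in> verts G - VD"
        using free_end[OF e0(1)] e0(1) by (metis DiffI head_in_verts tail_in_verts)
      then have "one v \<le> r" unfolding r_def
        by (intro member_le_sum) (auto simp: one_def)
      then show ?thesis using \<open>v \<in> verts G - VD\<close> by (simp add: one_def)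
    qed
    have one: "(\<lambda>v. one v / r) \<in> vertex_simplex"
      unfolding vertex_simplex_def using \<open>0 < r\<close>
      by (auto simp: sum_divide_distrib[symmetric] r_def[symmetric]) (auto simp: one_def)
    have neg: "vertex_form (\<theta> \<beta>) (\<lambda>v. one v / r) \<le> 0"
    proof -
      have cot: "edge_form (\<theta> \<beta> e) (one (tail G e)) (one (head G e)) \<le> cos (\<theta> \<beta> e) / sin (\<theta> \<beta> e)"
        if e: "e \<in> arcs G" for e
        using free_end[OF e] sin[OF e, of \<beta>] \<alpha>\<beta> e
        by (intro edge_form_le_cot) (auto simp: one_def)
      have other: "edge_form (\<theta> \<beta> e) (one (tail G e)) (one (head G e)) \<le> 1 / m"
        if e: "e \<in> arcs G" for e
      proof -
        have "m \<le> \<theta> \<beta> e"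
          using \<beta>l[OF e] \<delta>[OF e] \<gamma>6 m(1) unfolding \<theta>_def by linarith
        then have "1 / \<theta> \<beta> e \<le> 1 / m" using m(1) by (intro divide_left_mono) auto
        then show ?thesis
          using cot[OF e] cot_le_inverse[of "\<theta> \<beta> e"] range[OF e, of \<beta>] \<alpha>\<beta> by auto
      qed
      have first: "edge_form (\<theta> \<beta> e0) (one (tail G e0)) (one (head G e0)) \<le> - ?n / m"
      proof -
        define x where "x = pi - \<theta> \<beta> e0"
        have "\<beta> * len e0 = pi - 2 * \<gamma>" using e0 lmax by (simp add: \<beta>_def)
        then have x: "\<gamma> \<le> x" "x \<le> 3 * \<gamma>"
          using \<delta>[OF e0(1)] unfolding x_def \<theta>_def by linarith+
        have "edge_form (\<theta> \<beta> e0) (one (tail G e0)) (one (head G e0))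
            \<le> cos (pi - x) / sin (pi - x)"
          using cot[OF e0(1)] by (simp add: x_def)
        also have "\<dots> \<le> - 1 / (2 * x)"
          using x \<gamma> \<gamma>6 m by (intro cot_near_pi) auto
        also have "\<dots> \<le> - ?n / m"
        proof -
          have "?n * (2 * x) \<le> ?n * (2 * (3 * \<gamma>))" using x n by (intro mult_left_mono) auto
          also have "\<dots> \<le> m" using \<gamma>(2) by (simp add: algebra_simps)
          finally show ?thesis using x \<gamma>(1) m(1) by (simp add: field_simps)
        qed
        finally show ?thesis .
      qed
      have "vertex_form (\<theta> \<beta>) one =
          edge_form (\<theta> \<beta> e0) (one (tail G e0)) (one (head G e0)) +
          (\<Sum>e\<in>arcs G - {e0}. edge_form (\<theta> \<beta> e) (one (tail G e)) (one (head G e)))"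
        unfolding vertex_form_def using e0 by (intro sum.remove) auto
      \<comment> \<open>The other edges number less than \<open>?n\<close> and add at most
        \<open>1 / m\<close> each, so the longest edge outweighs them.\<close>
      also have "\<dots> \<le> - ?n / m + (\<Sum>e\<in>arcs G - {e0}. 1 / m)"
        using first other by (intro add_mono sum_mono) auto
      also have "\<dots> \<le> - ?n / m + ?n * (1 / m)"
        using m(1) by (simp add: divide_right_mono card_Diff1_le)
      finally have "vertex_form (\<theta> \<beta>) one \<le> 0" by simp
      moreover have "vertex_form (\<theta> \<beta>) (\<lambda>v. one v / r) = (1 / r)\<^sup>2 * vertex_form (\<theta> \<beta>) one"
        unfolding vertex_form_def sum_distrib_left
        by (intro sum.cong) (simp_all add: edge_form_scale[symmetric])
      ultimately show ?thesis by (simp add: mult_nonneg_nonpos)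
    qed
    have cont: "continuous_on {\<alpha>..\<beta>} (\<lambda>k. \<theta> k e)" for e
      unfolding \<theta>_def by (intro continuous_intros)
    obtain k u where ku: "k \<in> {\<alpha>..\<beta>}" "u \<in> vertex_simplex" "vertex_form (\<theta> k) u = 0"
      "\<forall>w\<in>vertex_simplex. 0 \<le> vertex_form (\<theta> k) w"
      by (rule ex_first_null_vector[OF \<alpha>\<beta> cont sin pos one neg])
    have sk: "0 < sin (\<theta> k e)" if "e \<in> arcs G" for e using sin that ku(1) by blast
    have flux: "vertex_flux (\<theta> k) u v = 0" if "v \<in> verts G - VD" for v
      using vertex_flux_eq_0[OF sk ku(4) ku(2,3) that] .
    have "0 < u v" if "v \<in> verts G - VD" for v
      using null_vector_pos[OF sk ku(2) flux that] .
    moreover have "u v = 0" if "v \<in> VD" for v using ku(2) that by (simp add: vertex_simplex_def)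
    moreover have "0 < k" using ku(1) \<alpha> by simp
    ultimately show ?thesis using sk flux unfolding \<theta>_def by blast
  qed
  then show ?thesis using that \<gamma>(1) by blast
qed

lemma vertex_flux_cong:
  assumes "\<And>e. e \<in> arcs G \<Longrightarrow> sin (\<theta> e) = sin (\<theta>' e)" "\<And>e. e \<in> arcs G \<Longrightarrow> cos (\<theta> e) = cos (\<theta>' e)"
  shows "vertex_flux \<theta> u v = vertex_flux \<theta>' u v"
  unfolding vertex_flux_def
  by (intro sum.cong) (auto simp: edge_flux_def assms dest!: incident_edgesD)

text \<open>On each edge two sines interpolate the end values \<open>u\<close>, so continuity and
  the Dirichlet conditions are built in. The outward derivatives sum to \<open>k\<close> times the
  flux.\<close>

lemma ex_eigenfunction_of_null_vector:
  assumes sin: "\<And>e. e \<in> arcs G \<Longrightarrow> sin (k * len e) \<noteq> 0"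
    and u: "\<And>v. v \<in> verts G - VD \<Longrightarrow> u v \<noteq> 0" "\<And>v. v \<in> VD \<Longrightarrow> u v = 0"
    and flux: "\<And>v. v \<in> verts G - VD \<Longrightarrow> vertex_flux (\<lambda>e. k * len e) u v = 0"
  shows "\<exists>f. eigenfunction G len VD (of_real (k\<^sup>2)) f \<and> full_support G len f"
proof -
  define g where "g e x = (u (tail G e) * sin (k * (len e - x)) + u (head G e) * sin (k * x))
    / sin (k * len e)" for e x
  define g' where "g' e x = k * (u (head G e) * cos (k * x) - u (tail G e) * cos (k * (len e - x)))
    / sin (k * len e)" for e x
  define f where "f e x = complex_of_real (g e x)" for e x
  define f' where "f' e x = complex_of_real (g' e x)" for e x
  have "(g e has_real_derivative g' e x) (at x)" for e x
    unfolding g_def g'_def divide_inverse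
    by (rule derivative_eq_intros refl | simp add: algebra_simps)+
  then have f: "(f e has_vector_derivative f' e x) (at x)" for e x
    unfolding f_def f'_def by (rule has_vector_derivative_complex_of_real)
  have "(g' e has_real_derivative - (k\<^sup>2 * g e x)) (at x)" for e x
    unfolding g_def g'_def divide_inverse
    by (rule derivative_eq_intros refl | simp add: algebra_simps power2_eq_square)+
  then have "(f' e has_vector_derivative complex_of_real (- (k\<^sup>2 * g e x))) (at x)" for e x
    unfolding f'_def by (rule has_vector_derivative_complex_of_real)
  then have f': "(f' e has_vector_derivative - (of_real (k\<^sup>2) * f e x)) (at x)" for e x
    by (simp add: f_def)
  have ends: "f e 0 = of_real (u (tail G e))" "f e (len e) = of_real (u (head G e))"
    if "e \<in> arcs G" for e
    using sin[OF that] by (simp_all add: f_def g_def)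
  have vals: "end_value G len f v e = of_real (u v)" if "e \<in> incident_edges G v" for v e
    using incident_edgesD[OF that] ends[of e] by (auto simp: end_value_def)
  have vd: "vector_derivative (f e) (at x within {0..len e}) = f' e x"
    if "e \<in> arcs G" "x \<in> {0..len e}" for e x
    using that len_pos f by (intro vector_derivative_within_closed_interval)
      (auto intro: has_vector_derivative_at_within)
  have outward: "outward_derivative G len f v e = of_real (k *
      (if v = tail G e then edge_flux (k * len e) (u (tail G e)) (u (head G e))
       else edge_flux (k * len e) (u (head G e)) (u (tail G e))))"
    if "e \<in> incident_edges G v" for v e
    using incident_edgesD[OF that] vd[of e 0] vd[of e "len e"] len_pos[of e]
    by (auto simp: outward_derivative_def f'_def g'_def edge_flux_def
        minus_divide_left right_diff_distrib)
  have "\<not> vanishes_on_edge len f e" if e: "e \<in> arcs G" for e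
  proof
    assume "vanishes_on_edge len f e"
    then have "f e 0 = 0" "f e (len e) = 0"
      using len_pos[OF e] by (simp_all add: vanishes_on_edge_def)
    then have "u (tail G e) = 0" "u (head G e) = 0" using ends[OF e] by simp_all
    then show False
      using u(1) free_end[OF e] e by (metis DiffI head_in_verts tail_in_verts)
  qed
  then have full: "full_support G len f" by (simp add: full_support_def)
  have "eigenfunction G len VD (of_real (k\<^sup>2)) f"
  proof (rule eigenfunctionI[OF compact_metric_graph_axioms f f' _ _ full])
    show "dirichlet_condition G len f v" if "v \<in> VD" for v
      using u(2)[OF that] vals by (simp add: dirichlet_condition_def)
    show "standard_condition G len f v" if "v \<in> verts G - VD" for v
    proof -
      have "(\<Sum>e\<in>incident_edges G v. outward_derivative G len f v e) =
          of_real (k * vertex_flux (\<lambda>e. k * len e) u v)"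
        unfolding vertex_flux_def sum_distrib_left of_real_sum
        by (intro sum.cong refl outward)
      then show ?thesis
        using flux[OF that] vals by (simp add: standard_condition_def)
    qed
  qed
  then show ?thesis using full by blast
qed

text \<open>Modulo \<open>2 * pi\<close>, adding \<open>t\<close> to \<open>k\<close> shifts the
  angles by a small \<open>\<delta>\<close>. A null vector for the shifted angles is therefore one
  for \<open>k + t\<close>, and \<open>k > 0\<close> gives \<open>k + t > T\<close>.\<close>

lemma ex_full_support_eigenfunction:
  assumes "0 < T"
  shows "\<exists>k>T. \<exists>f. eigenfunction G len VD (of_real (k\<^sup>2)) f \<and> full_support G len f"
proof -
  obtain \<gamma> where "0 < \<gamma>" and \<gamma>: "\<And>\<delta>. (\<And>e. e \<in> arcs G \<Longrightarrow> \<bar>\<delta> e\<bar> \<le> \<gamma>) \<Longrightarrow>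
       \<exists>k>0. \<exists>u. (\<forall>v\<in>verts G - VD. 0 < u v) \<and> (\<forall>v\<in>VD. u v = 0) \<and>
         (\<forall>e\<in>arcs G. 0 < sin (k * len e + \<delta> e)) \<and>
         (\<forall>v\<in>verts G - VD. vertex_flux (\<lambda>e. k * len e + \<delta> e) u v = 0)"
    using ex_null_vector_near by blast
  obtain t p where t: "T \<le> t" "\<And>e. e \<in> arcs G \<Longrightarrow> \<bar>t * len e - 2 * pi * of_int (p e)\<bar> \<le> \<gamma>"
    using simultaneous_recurrence[OF finite_arcs \<open>0 < T\<close> \<open>0 < \<gamma>\<close>] by metis
  define \<delta> where "\<delta> e = t * len e - 2 * pi * of_int (p e)" for e
  have "\<And>e. e \<in> arcs G \<Longrightarrow> \<bar>\<delta> e\<bar> \<le> \<gamma>" using t(2) by (simp add: \<delta>_def)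
  from \<gamma>[of \<delta>, OF this] obtain k u where "0 < k"
    and u: "\<forall>v\<in>verts G - VD. 0 < u v" "\<forall>v\<in>VD. u v = 0"
    and sin: "\<forall>e\<in>arcs G. 0 < sin (k * len e + \<delta> e)"
    and flux: "\<forall>v\<in>verts G - VD. vertex_flux (\<lambda>e. k * len e + \<delta> e) u v = 0"
    by blast
  have "(k + t) * len e = (k * len e + \<delta> e) + 2 * pi * of_int (p e)" for e
    by (simp add: \<delta>_def algebra_simps)
  then have eq: "sin ((k + t) * len e) = sin (k * len e + \<delta> e)"
    "cos ((k + t) * len e) = cos (k * len e + \<delta> e)" for e
    using sin_cos_eq_iff by blast+
  have "\<exists>f. eigenfunction G len VD (of_real ((k + t)\<^sup>2)) f \<and> full_support G len f"
  proof (rule ex_eigenfunction_of_null_vector)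
    show "sin ((k + t) * len e) \<noteq> 0" if "e \<in> arcs G" for e
      using sin that eq by fastforce
    show "vertex_flux (\<lambda>e. (k + t) * len e) u v = 0" if "v \<in> verts G - VD" for v
      using flux that vertex_flux_cong[of "\<lambda>e. (k + t) * len e" "\<lambda>e. k * len e + \<delta> e"] eq by simp
    show "u v \<noteq> 0" if "v \<in> verts G - VD" for v
      using u(1)[rule_format, OF that] by simp
    show "u v = 0" if "v \<in> VD" for v using u(2) that by blast
  qed
  moreover have "T < k + t" using t(1) \<open>0 < k\<close> by simp
  ultimately show ?thesis by blast
qed

end

section \<open>The interval with Dirichlet conditions at both ends\<close>

text \<open>Both ends have degree one, so no other edge meets \<open>e\<close>, and connectedness
  makes \<open>e\<close> the whole graph. Sines vanishing at both ends then serve.\<close>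

lemma ex_full_support_eigenfunction_single_edge:
  assumes G: "compact_metric_graph G len"
    and con: "Digraph_Component.connected G"
    and deg: "\<And>v. v \<in> VD \<Longrightarrow> vertex_degree G v = 1"
    and e: "e \<in> arcs G" "tail G e \<in> VD" "head G e \<in> VD"
  shows "\<exists>k>T. \<exists>f. eigenfunction G len VD (of_real (k\<^sup>2)) f \<and> full_support G len f"
proof -
  interpret compact_metric_graph G len by (rule G)
  have uniq: "e' = e" if "e' \<in> arcs G" "tail G e' \<in> {tail G e, head G e} \<or> head G e' \<in> {tail G e, head G e}" for e'
  proof -
    have "\<exists>v\<in>VD. e \<in> incident_edges G v \<and> e' \<in> incident_edges G v"
      using that e by (fastforce simp: incident_edges_def)
    then obtain v where "v \<in> VD" "e \<in> incident_edges G v" "e' \<in> incident_edges G v" by blast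
    then show ?thesis
      using deg[of v] unfolding vertex_degree_def by (metis card_1_singletonE singletonD)
  qed
  have V: "{tail G e, head G e} = verts G"
  proof (rule connected_closed_subset[OF con])
    show "tail G e' \<in> {tail G e, head G e} \<longleftrightarrow> head G e' \<in> {tail G e, head G e}"
      if "e' \<in> arcs G" for e'
      using uniq[OF that] by blast
  qed (use e(1) in simp_all)
  have verts: "verts G \<subseteq> VD" unfolding V[symmetric] using e by simp
  have arcs: "e' = e" if "e' \<in> arcs G" for e'
    using uniq[OF that] tail_in_verts[OF that] V by blast
  obtain n :: nat where "T * len e / pi < real n" using reals_Archimedean2 by blast
  then have n: "T * len e < real (Suc n) * pi"
    by (simp add: divide_less_eq distrib_right add_strict_increasing2)
  \<comment> \<open>\<open>Suc n\<close> instead of \<open>n\<close> keeps \<open>k\<close> positive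
    even for negative \<open>T\<close>.\<close>
  define k where "k = real (Suc n) * pi / len e"
  have k: "T < k" "k * len e = real (Suc n) * pi"
    using n len_pos[OF e(1)] by (simp_all add: k_def less_divide_eq)
  define f where "f = (\<lambda>(e::'b) x. complex_of_real (sin (k * x)))"
  have f: "(f e' has_vector_derivative of_real (k * cos (k * x))) (at x)" for e' x
    unfolding f_def
    by (intro has_vector_derivative_complex_of_real) (auto intro!: derivative_eq_intros)
  have "((\<lambda>x. complex_of_real (k * cos (k * x))) has_vector_derivative
      of_real (- (k\<^sup>2 * sin (k * x)))) (at x)" for x
    by (intro has_vector_derivative_complex_of_real)
       (auto intro!: derivative_eq_intros simp: power2_eq_square)
  then have f': "((\<lambda>x. complex_of_real (k * cos (k * x))) has_vector_derivative
      - (of_real (k\<^sup>2) * f e' x)) (at x)" for e' x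
    by (simp add: f_def)
  have "\<not> vanishes_on_edge len f e"
  proof
    assume v: "vanishes_on_edge len f e"
    \<comment> \<open>Here the sine equals 1; the point lies on the edge because
      \<open>k * len e\<close> is at least \<open>pi\<close>.\<close>
    define x where "x = pi / (2 * k)"
    have "0 < k" using len_pos[OF e(1)] by (simp add: k_def)
    moreover have "pi \<le> k * len e" using k(2) by (simp add: distrib_right)
    then have "pi \<le> 2 * (k * len e)" using pi_gt_zero by linarith
    ultimately have "x \<in> {0..len e}"
      by (simp add: x_def field_simps)
    then have "f e x = 0" using v by (simp add: vanishes_on_edge_def)
    then show False using \<open>0 < k\<close> by (simp add: f_def x_def)
  qed
  then have full: "full_support G len f"
    using arcs by (auto simp: full_support_def)
  have "eigenfunction G len VD (of_real (k\<^sup>2)) f"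
  proof (rule eigenfunctionI[OF G f f' _ _ full])
    show "dirichlet_condition G len f v" for v
      using arcs k(2) sin_npi[of "Suc n"]
      by (auto simp: dirichlet_condition_def end_value_def f_def incident_edges_def)
    show "standard_condition G len f v" if "v \<in> verts G - VD" for v
      using that verts by blast
  qed
  then show ?thesis using k(1) full by blast
qed

section \<open>The increasing sequence of eigenvalues\<close>

theorem theorem2:
  fixes G :: "('v, 'e) pre_digraph"
    and len :: "'e \<Rightarrow> real"
    and VD :: "'v set"
  assumes "compact_metric_graph G len"
    and "Digraph_Component.connected G"
    and "VD \<subseteq> verts G"
    and "VD \<noteq> {}"
    and "\<And>v. v \<in> VD \<Longrightarrow> vertex_degree G v = 1"
  shows "\<exists>(ev :: nat \<Rightarrow> real) (\<psi> :: nat \<Rightarrow> 'e \<Rightarrow> real \<Rightarrow> complex).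
           strict_mono ev \<and>
           (\<forall>k. eigenvalue G len VD (of_real (ev k)) \<and>
                eigenfunction G len VD (of_real (ev k)) (\<psi> k) \<and>
                full_support G len (\<psi> k))"
proof -
  let ?P = "\<lambda>\<mu>. \<exists>f. eigenfunction G len VD (of_real \<mu>) f \<and> full_support G len f"
  have large: "\<exists>k>T. ?P (k\<^sup>2)" if "0 < T" for T :: real
  proof (cases "\<exists>e\<in>arcs G. tail G e \<in> VD \<and> head G e \<in> VD")
    case True
    then show ?thesis
      using ex_full_support_eigenfunction_single_edge[OF assms(1,2,5)] by blast
  next
    case False
    interpret dirichlet_graph G len VD
      using assms False by (intro dirichlet_graph.intro dirichlet_graph_axioms.intro) auto
    show ?thesis by (rule ex_full_support_eigenfunction[OF that])
  qed
  have step: "\<exists>\<mu>'. ?P \<mu>' \<and> \<mu> < \<mu>'" for \<mu> :: real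
  proof -
    \<comment> \<open>The bound 1 ensures \<open>k\<^sup>2 \<ge> k\<close>, so that the eigenvalue
      \<open>k\<^sup>2\<close>, and not only \<open>k\<close>, exceeds \<open>\<mu>\<close>.\<close>
    have "0 < max 1 \<mu>" by simp
    from large[OF this] obtain k where k: "max 1 \<mu> < k" "?P (k\<^sup>2)" by blast
    then have "k \<le> k\<^sup>2" by (intro self_le_power) auto
    then show ?thesis using k by (intro exI[of _ "k\<^sup>2"]) auto
  qed
  obtain ev :: "nat \<Rightarrow> real" where ev: "\<And>n. ?P (ev n)" "\<And>n. ev n < ev (Suc n)"
    using dependent_nat_choice[of "\<lambda>_. ?P" "\<lambda>_ \<mu> \<mu>'. \<mu> < \<mu>'"] step by blast
  then obtain \<psi> where \<psi>: "\<And>n. eigenfunction G len VD (of_real (ev n)) (\<psi> n) \<and> full_support G len (\<psi> n)"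
    by metis
  have "strict_mono ev" using ev(2) by (simp add: strict_mono_Suc_iff)
  moreover have "eigenvalue G len VD (of_real (ev n))" for n
    using \<psi> unfolding eigenvalue_def by blast
  ultimately show ?thesis using \<psi> by blast
qed

end
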